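(* There exists a recursive coloring function $c:\mathbb{N}\rightarrow r$ (for some natural number $r\geq 2$) such that for every infinite $\Delta^0_3$ set $A\subseteq\mathbb{Z}^+$ with weak apartness, there exist $x\ll w_1\ll w_2$ in $A$ such that $c(w_1+w_2)\neq c(x+w_1+w_2)$. Hence $FS^{\leq 3}(A)$ is not monochromatic under $c$.
   Context: For $x=\sum_{i=0}^{k}2^{n_i}\in\mathbb{Z}^+$ with $n_0<\cdots<n_k$, set $\mu(x)=n_k$ and $\lambda(x)=n_0$. For positive integers $x<y$, write $x\ll y$ if $\mu(x)<\lambda(y)$. For each $n$, $B^n=\{x\in\mathbb{Z}^+:\mu(x)=n\}$. A set $A$ has weak apartness if for every natural number $m$, $B^m\cap A$ has at most one element, and for every natural number $l$, there are at most two $x\in A$ with $\lambda(x)=l$. $FS^{\leq 3}(A)=\{\sum_{x\in F}x: F\subseteq A,\ F \text{ nonempty},\ |F|\leq 3\}$. *)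

theory Defs
  imports Main
begin

datatype recf = Zero | Succ | Proj nat | Comp recf "recf list" | Prec recf recf | Mini recf

inductive eval :: "recf \<Rightarrow> nat list \<Rightarrow> nat \<Rightarrow> bool" where
  eval_Zero: "eval Zero xs 0"
| eval_Succ: "eval Succ (x # xs) (Suc x)"
| eval_Proj: "i < length xs \<Longrightarrow> eval (Proj i) xs (xs ! i)"
| eval_Comp: "length ys = length gs \<Longrightarrow> (\<forall>i < length gs. eval (gs ! i) xs (ys ! i))
      \<Longrightarrow> eval f ys z \<Longrightarrow> eval (Comp f gs) xs z"
| eval_Prec0: "eval f xs z \<Longrightarrow> eval (Prec f g) (0 # xs) z"
| eval_PrecS: "eval (Prec f g) (n # xs) y \<Longrightarrow> eval g (y # n # xs) z
      \<Longrightarrow> eval (Prec f g) (Suc n # xs) z"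
| eval_Mini: "eval f (n # xs) 0 \<Longrightarrow> (\<forall>m < n. \<exists>y. eval f (m # xs) y \<and> y \<noteq> 0)
      \<Longrightarrow> eval (Mini f) xs n"

definition recursive_fun :: "(nat \<Rightarrow> nat) \<Rightarrow> bool" where
  "recursive_fun c \<longleftrightarrow> (\<exists>t. \<forall>n. eval t [n] (c n))"

definition recursive_rel4 :: "(nat \<Rightarrow> nat \<Rightarrow> nat \<Rightarrow> nat \<Rightarrow> bool) \<Rightarrow> bool" where
  "recursive_rel4 P \<longleftrightarrow>
     (\<exists>t. \<forall>x a b d. eval t [x, a, b, d] (if P x a b d then 1 else 0))"

definition Sigma3 :: "nat set \<Rightarrow> bool" where
  "Sigma3 A \<longleftrightarrow> (\<exists>P. recursive_rel4 P \<and> (\<forall>x. x \<in> A \<longleftrightarrow> (\<exists>a. \<forall>b. \<exists>d. P x a b d)))"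

definition Pi3 :: "nat set \<Rightarrow> bool" where
  "Pi3 A \<longleftrightarrow> (\<exists>P. recursive_rel4 P \<and> (\<forall>x. x \<in> A \<longleftrightarrow> (\<forall>a. \<exists>b. \<forall>d. P x a b d)))"

definition Delta3 :: "nat set \<Rightarrow> bool" where
  "Delta3 A \<longleftrightarrow> Sigma3 A \<and> Pi3 A"

definition mu :: "nat \<Rightarrow> nat" where
  "mu x = Max {n. bit x n}"

definition lam :: "nat \<Rightarrow> nat" where
  "lam x = Min {n. bit x n}"

definition ll :: "nat \<Rightarrow> nat \<Rightarrow> bool" (infix "\<lless>" 50) where
  "x \<lless> y \<longleftrightarrow> x < y \<and> mu x < lam y"

definition weak_apart :: "nat set \<Rightarrow> bool" where
  "weak_apart A \<longleftrightarrow>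
     (\<forall>m. \<forall>x \<in> A. \<forall>y \<in> A. mu x = m \<and> mu y = m \<longrightarrow> x = y) \<and>
     (\<forall>l. finite {x \<in> A. lam x = l} \<and> card {x \<in> A. lam x = l} \<le> 2)"

definition FS3 :: "nat set \<Rightarrow> nat set" where
  "FS3 A = {\<Sum>F | F. F \<subseteq> A \<and> F \<noteq> {} \<and> finite F \<and> card F \<le> 3}"

end

theory Submission
  imports Defs "HOL-Library.Nat_Bijection"
begin

text \<open>
  The double limit lemma approximates every \<open>\<Delta>\<^sub>3\<close> set by a recursive family with two stages
  \<open>j\<close> and \<open>t\<close>.  A sum \<open>n = x + w\<^sub>1 + w\<^sub>2\<close> does not show where its summands begin and end, but
  \<open>t = \<mu> n = \<mu> w\<^sub>2\<close> can be read off, and \<open>j = \<lambda> w\<^sub>1\<close> is the bit of \<open>n\<close> that follows the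
  bit \<open>\<mu> x\<close>.  So we mark pairs \<open>(i, j)\<close> of bit positions, depending on \<open>t\<close>, and color \<open>n\<close> by the
  parity of the number of marked pairs among its pairs of adjacent bits.  Putting \<open>x\<close> in front of
  \<open>w\<^sub>1 + w\<^sub>2\<close> adds the pairs inside \<open>x\<close> and the pair \<open>(\<mu> x, \<lambda> w\<^sub>1)\<close>; hence the color changes as soon
  as that pair is marked exactly when the number of marked pairs inside \<open>x\<close> is even.

  To achieve this, at stage \<open>j\<close> the \<open>e\<close>-th set claims its (approximate) first \<open>2\<^sup>e\<close> elements, and
  position \<open>i\<close> is decided by the least \<open>e\<close> claiming an \<open>x\<close> with \<open>\<mu> x = i\<close>.  Fewer than
  \<open>2\<^sup>e\<close> positions are taken by smaller indices, so for every large \<open>j\<close> one of the first \<open>2\<^sup>e\<close>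
  elements of the \<open>e\<close>-th set, which have distinct \<open>\<mu>\<close>, is served.  The smaller indices need not
  stabilize; therefore \<open>x\<close> is chosen after \<open>w\<^sub>1\<close>.
\<close>

subsection \<open>Closure properties of computable functions\<close>

text \<open>
  Functions act on environments, that is argument lists of fixed length.  The variables are
  \<open>hd v\<close>, \<open>hd (tl v)\<close>, and so on, and a binder conses its variable to the environment.
\<close>

definition computable :: "nat \<Rightarrow> (nat list \<Rightarrow> nat) \<Rightarrow> bool" where
  "computable n f \<longleftrightarrow> (\<exists>t. \<forall>xs. length xs = n \<longrightarrow> eval t xs (f xs))"

definition decidable :: "nat \<Rightarrow> (nat list \<Rightarrow> bool) \<Rightarrow> bool" where
  "decidable n P \<longleftrightarrow> computable n (\<lambda>xs. of_bool (P xs))"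

lemma computable_cong:
  "(\<And>xs. length xs = n \<Longrightarrow> f xs = g xs) \<Longrightarrow> computable n f \<longleftrightarrow> computable n g"
  unfolding computable_def by auto

lemma computable_comp_list:
  assumes g: "computable (length fs) g" and fs: "\<And>f. f \<in> set fs \<Longrightarrow> computable n f"
  shows "computable n (\<lambda>xs. g (map (\<lambda>f. f xs) fs))"
proof -
  from g obtain t where t: "\<And>ys. length ys = length fs \<Longrightarrow> eval t ys (g ys)"
    unfolding computable_def by auto
  have "\<forall>f\<in>set fs. \<exists>u. \<forall>xs. length xs = n \<longrightarrow> eval u xs (f xs)"
    using fs unfolding computable_def by auto
  then obtain u where u: "\<And>f xs. f \<in> set fs \<Longrightarrow> length xs = n \<Longrightarrow> eval (u f) xs (f xs)"
    by metis
  have "eval (Comp t (map u fs)) xs (g (map (\<lambda>f. f xs) fs))" if "length xs = n" for xs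
    by (rule eval_Comp[where ys = "map (\<lambda>f. f xs) fs"]) (use t u that in auto)
  then show ?thesis unfolding computable_def by blast
qed

lemma computable_nth: "i < n \<Longrightarrow> computable n (\<lambda>xs. xs ! i)"
  unfolding computable_def using eval_Proj by blast

text \<open>Substitution of a whole environment. It is needed for weakening
  (\<open>computable_tl\<close>) and for instantiating the innermost variable
  (\<open>computable_Cons\<close>).\<close>

lemma computable_comp_env:
  assumes f: "computable m f" and h: "\<And>i. i < m \<Longrightarrow> computable n (\<lambda>xs. h xs ! i)"
    and len: "\<And>xs. length xs = n \<Longrightarrow> length (h xs) = m"
  shows "computable n (\<lambda>xs. f (h xs))"
proof -
  let ?fs = "map (\<lambda>i xs. h xs ! i) [0..<m]"
  have "computable n (\<lambda>xs. f (map (\<lambda>g. g xs) ?fs))"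
    by (rule computable_comp_list) (use f h in auto)
  moreover have "map (\<lambda>g. g xs) ?fs = h xs" if "length xs = n" for xs
    using len[OF that] by (auto intro: nth_equalityI)
  ultimately show ?thesis
    by (subst (asm) computable_cong) (auto simp: comp_def)
qed

lemma computable_tl: "computable n f \<Longrightarrow> computable (Suc n) (\<lambda>xs. f (tl xs))"
proof (rule computable_comp_env)
  show "computable (Suc n) (\<lambda>xs. tl xs ! i)" if "i < n" for i
    using computable_nth[of "Suc i" "Suc n"] that
    by (subst computable_cong[where g = "\<lambda>xs. xs ! Suc i"]) (auto simp: nth_tl)
qed auto

lemma computable_Cons:
  assumes "computable (Suc n) f" "computable n a"
  shows "computable n (\<lambda>xs. f (a xs # xs))"
proof (rule computable_comp_env[OF assms(1)])
  show "computable n (\<lambda>xs. (a xs # xs) ! i)" if "i < Suc n" for i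
    using assms(2) computable_nth[of "i - 1" n] that by (cases i) auto
qed auto

lemma computable_hd: "computable (Suc n) hd"
  using computable_nth[of 0 "Suc n"]
  by (subst computable_cong[where g = "\<lambda>xs. xs ! 0"]) (auto simp: length_Suc_conv)

lemmas computable_var1 = computable_tl[OF computable_hd]
lemmas computable_var2 = computable_tl[OF computable_var1]
lemmas computable_var3 = computable_tl[OF computable_var2]
lemmas computable_var4 = computable_tl[OF computable_var3]
lemmas computable_var5 = computable_tl[OF computable_var4]
lemmas computable_var6 = computable_tl[OF computable_var5]
lemmas computable_var7 = computable_tl[OF computable_var6]

lemmas computable_var = computable_hd computable_var1 computable_var2 computable_var3 computable_var4
  computable_var5 computable_var6 computable_var7

lemma computable_Suc: "computable n a \<Longrightarrow> computable n (\<lambda>xs. Suc (a xs))"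
proof -
  assume a: "computable n a"
  have "computable 1 (\<lambda>xs. Suc (hd xs))"
    unfolding computable_def
    by (rule exI[of _ Succ]) (auto simp: length_Suc_conv intro: eval_Succ)
  from computable_comp_list[of "[a]" "\<lambda>xs. Suc (hd xs)" n] this a show ?thesis by simp
qed

lemma computable_const: "computable n (\<lambda>_. k)"
proof (induction k)
  case 0
  show ?case unfolding computable_def using eval_Zero by blast
qed (rule computable_Suc)

text \<open>As in \<open>eval_PrecS\<close>, the previous value precedes the counter in the
  environment of \<open>g\<close>: \<open>hd ys\<close> is the value and \<open>hd (tl ys)\<close>
  the counter.\<close>

lemma computable_rec_nat:
  assumes f: "computable n f"
    and g: "computable (Suc (Suc n)) (\<lambda>ys. g (hd (tl ys)) (hd ys) (tl (tl ys)))"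
    and b: "computable n b"
  shows "computable n (\<lambda>xs. rec_nat (f xs) (\<lambda>m y. g m y xs) (b xs))"
proof -
  from f obtain t where t: "\<And>xs. length xs = n \<Longrightarrow> eval t xs (f xs)"
    unfolding computable_def by auto
  from g obtain u where u: "\<And>xs m y. length xs = n \<Longrightarrow> eval u (y # m # xs) (g m y xs)"
    unfolding computable_def by (metis length_Cons list.sel(1) list.sel(3))
  have "eval (Prec t u) (k # xs) (rec_nat (f xs) (\<lambda>m y. g m y xs) k)" if "length xs = n" for k xs
    by (induction k) (use t u that in \<open>auto intro: eval_Prec0 eval_PrecS\<close>)
  then have "computable (Suc n) (\<lambda>ys. rec_nat (f (tl ys)) (\<lambda>m y. g m y (tl ys)) (hd ys))"
    unfolding computable_def by (intro exI[of _ "Prec t u"]) (auto simp: length_Suc_conv)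
  from computable_Cons[OF this b] show ?thesis by simp
qed

lemma computable_add:
  assumes "computable n a" "computable n b"
  shows "computable n (\<lambda>xs. a xs + b xs)"
proof -
  have "a + b = rec_nat a (\<lambda>_. Suc) b" for a b :: nat by (induction b) auto
  then show ?thesis
    using assms by (simp only:) (intro computable_rec_nat computable_Suc computable_var)
qed

lemma computable_mult:
  assumes "computable n a" "computable n b"
  shows "computable n (\<lambda>xs. a xs * b xs)"
proof -
  have "a * b = rec_nat 0 (\<lambda>_ y. y + a) b" for a b :: nat by (induction b) auto
  then show ?thesis
    using assms
    by (simp only:) (intro computable_rec_nat computable_add computable_const computable_var
        computable_tl[OF computable_tl])
qed

lemma computable_power:
  assumes "computable n a" "computable n b"
  shows "computable n (\<lambda>xs. a xs ^ b xs)"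
proof -
  have "a ^ b = rec_nat 1 (\<lambda>_ y. y * a) b" for a b :: nat by (induction b) auto
  then show ?thesis
    using assms
    by (simp only:) (intro computable_rec_nat computable_mult computable_const computable_var
        computable_tl[OF computable_tl])
qed

lemma computable_pred:
  assumes "computable n a"
  shows "computable n (\<lambda>xs. a xs - 1)"
proof -
  have "a - 1 = rec_nat 0 (\<lambda>m _. m) a" for a :: nat by (induction a) auto
  then show ?thesis
    using assms by (simp only:) (intro computable_rec_nat computable_const computable_var)
qed

lemma computable_diff:
  assumes "computable n a" "computable n b"
  shows "computable n (\<lambda>xs. a xs - b xs)"
proof -
  have eq: "rec_nat a (\<lambda>_ y. y - 1) b = a - b" for a b :: nat by (induction b) auto
  from computable_rec_nat[where g = "\<lambda>_ y _. y - 1", OF assms(1) computable_pred[OF computable_hd] assms(2)]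
  show ?thesis by (simp only: eq)
qed

lemma computable_sum:
  assumes "computable n b" "computable (Suc n) (\<lambda>ys. f (hd ys) (tl ys))"
  shows "computable n (\<lambda>xs. \<Sum>k<b xs. f k xs)"
proof -
  have "(\<Sum>k<b. f k xs) = rec_nat 0 (\<lambda>k y. y + f k xs) b" for b xs by (induction b) auto
  then show ?thesis
    using assms computable_tl[OF assms(2)]
    by (simp only:) (intro computable_rec_nat computable_add computable_const computable_var)
qed

section \<open>Decidable predicates and bounded quantifiers\<close>

lemma computable_of_bool: "decidable n P \<Longrightarrow> computable n (\<lambda>xs. of_bool (P xs))"
  by (simp add: decidable_def)

lemma decidable_not: "decidable n P \<Longrightarrow> decidable n (\<lambda>xs. \<not> P xs)"
proof -
  assume P: "decidable n P"
  have "of_bool (\<not> P) = 1 - (of_bool P :: nat)" for P by simp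
  then show ?thesis
    unfolding decidable_def
    by (simp only:) (intro computable_diff computable_const computable_of_bool P)
qed

lemma decidable_conj:
  assumes "decidable n P" "decidable n Q"
  shows "decidable n (\<lambda>xs. P xs \<and> Q xs)"
  unfolding decidable_def of_bool_conj using assms
  by (intro computable_mult computable_of_bool)

lemma decidable_disj:
  assumes "decidable n P" "decidable n Q"
  shows "decidable n (\<lambda>xs. P xs \<or> Q xs)"
proof -
  have "decidable n (\<lambda>xs. \<not> (\<not> P xs \<and> \<not> Q xs))"
    using assms by (intro decidable_not decidable_conj)
  then show ?thesis by simp
qed

lemma decidable_imp:
  "decidable n P \<Longrightarrow> decidable n Q \<Longrightarrow> decidable n (\<lambda>xs. P xs \<longrightarrow> Q xs)"
  unfolding imp_conv_disj by (intro decidable_disj decidable_not)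

lemma computable_if:
  assumes "decidable n P" "computable n a" "computable n b"
  shows "computable n (\<lambda>xs. if P xs then a xs else b xs)"
proof -
  have "(if P then a else b) = of_bool P * a + of_bool (\<not> P) * b" for P and a b :: nat by simp
  then show ?thesis
    using assms
    by (simp only:) (intro computable_add computable_mult computable_of_bool decidable_not)
qed

lemma decidable_less:
  assumes "computable n a" "computable n b"
  shows "decidable n (\<lambda>xs. a xs < b xs)"
proof -
  have "of_bool (a < b) = 1 - (1 - (b - a))" for a b :: nat by auto
  then show ?thesis
    unfolding decidable_def using assms by (simp only:) (intro computable_diff computable_const)
qed

lemma decidable_le:
  "computable n a \<Longrightarrow> computable n b \<Longrightarrow> decidable n (\<lambda>xs. a xs \<le> b xs)"
  unfolding not_less[symmetric] by (intro decidable_not decidable_less)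

lemma decidable_eq:
  "computable n a \<Longrightarrow> computable n b \<Longrightarrow> decidable n (\<lambda>xs. a xs = b xs)"
  unfolding order_eq_iff by (intro decidable_conj decidable_le)

lemma decidable_bex:
  assumes "computable n b" "decidable (Suc n) (\<lambda>ys. P (hd ys) (tl ys))"
  shows "decidable n (\<lambda>xs. \<exists>k<b xs. P k xs)"
proof -
  have "decidable n (\<lambda>xs. 0 < (\<Sum>k<b xs. of_bool (P k xs) :: nat))"
    using assms by (intro decidable_less computable_sum computable_const computable_of_bool)
  moreover have "0 < (\<Sum>k<b. of_bool (P k xs) :: nat) \<longleftrightarrow> (\<exists>k<b. P k xs)" for b xs
    by (induction b) (auto simp: less_Suc_eq)
  ultimately show ?thesis by simp
qed

lemma decidable_ball:
  assumes "computable n b" "decidable (Suc n) (\<lambda>ys. P (hd ys) (tl ys))"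
  shows "decidable n (\<lambda>xs. \<forall>k<b xs. P k xs)"
proof -
  have "decidable n (\<lambda>xs. \<not> (\<exists>k<b xs. \<not> P k xs))"
    using assms by (intro decidable_not decidable_bex)
  then show ?thesis by simp
qed

lemma computable_div:
  assumes "computable n a" "computable n b"
  shows "computable n (\<lambda>xs. a xs div b xs)"
proof -
  \<comment> \<open>The quotient counts the positive multiples of \<open>b\<close> up to
    \<open>a\<close>; the guard \<open>0 < b\<close> reproduces the convention
    \<open>a div 0 = 0\<close>.\<close>
  have div_eq: "a div b = (\<Sum>q<a. of_bool (0 < b \<and> Suc q * b \<le> a))" for a b :: nat
  proof (cases "b = 0")
    case False
    then have "{..<a} \<inter> {q. 0 < b \<and> Suc q * b \<le> a} = {..<a div b}"
      using less_eq_div_iff_mult_less_eq[of b "Suc _" a]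
      by (auto simp: Suc_le_eq intro: less_le_trans[OF _ div_le_dividend])
    then show ?thesis
      by (simp only: sum_of_bool_eq finite_lessThan card_lessThan of_nat_id)
  qed simp
  show ?thesis
    unfolding div_eq using assms computable_tl[OF assms(1)] computable_tl[OF assms(2)]
    by (intro computable_sum computable_of_bool decidable_conj decidable_less decidable_le
        computable_mult computable_Suc computable_const computable_var)
qed

lemma decidable_bit:
  assumes "computable n a" "computable n b"
  shows "decidable n (\<lambda>xs. bit (a xs) (b xs))"
proof -
  have "bit a b \<longleftrightarrow> a div 2 ^ b - 2 * (a div 2 ^ b div 2) = 1" for a b :: nat
    by (simp add: bit_iff_odd minus_mult_div_eq_mod odd_iff_mod_2_eq_one)
  then show ?thesis
    using assms
    by (simp only:) (intro decidable_eq computable_diff computable_mult computable_div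
        computable_power computable_const)
qed

lemmas computable_intros =
  computable_var computable_const computable_Suc computable_add computable_mult computable_power
  computable_diff computable_sum computable_of_bool computable_if computable_div
  decidable_not decidable_conj decidable_disj decidable_imp decidable_less decidable_le
  decidable_eq decidable_bex decidable_ball decidable_bit

lemma decidable_even:
  assumes "computable n a"
  shows "decidable n (\<lambda>xs. even (a xs))"
proof -
  have "even a \<longleftrightarrow> \<not> bit a 0" for a :: nat by (simp add: bit_0)
  then show ?thesis
    using assms by (simp only:) (intro computable_intros)
qed

section \<open>Pairing and unpairing\<close>

lemma computable_prod_encode:
  "computable n a \<Longrightarrow> computable n b \<Longrightarrow> computable n (\<lambda>xs. prod_encode (a xs, b xs))"
  unfolding prod_encode_def triangle_def split_conv by (intro computable_intros)

text \<open>Both components of a pair are at most its code, so a bounded search finds them; only the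
  true component passes the test, and the sum extracts it.\<close>

lemma fst_prod_decode_sum:
  "fst (prod_decode k) = (\<Sum>a<Suc k. if \<exists>b<Suc k. prod_encode (a, b) = k then a else 0)"
proof -
  obtain a b where ab: "k = prod_encode (a, b)"
    by (metis prod_decode_inverse surj_pair)
  then have "(\<exists>b<Suc k. prod_encode (a', b) = k) \<longleftrightarrow> a' = a" for a'
    by (auto simp: less_Suc_eq_le le_prod_encode_2)
  moreover have "a < Suc k" by (simp add: ab less_Suc_eq_le le_prod_encode_1)
  ultimately show ?thesis by (simp add: ab sum.delta del: sum.lessThan_Suc)
qed

lemma snd_prod_decode_sum:
  "snd (prod_decode k) = (\<Sum>b<Suc k. if \<exists>a<Suc k. prod_encode (a, b) = k then b else 0)"
proof -
  obtain a b where ab: "k = prod_encode (a, b)"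
    by (metis prod_decode_inverse surj_pair)
  then have "(\<exists>a<Suc k. prod_encode (a, b') = k) \<longleftrightarrow> b' = b" for b'
    by (auto simp: less_Suc_eq_le le_prod_encode_1)
  moreover have "b < Suc k" by (simp add: ab less_Suc_eq_le le_prod_encode_2)
  ultimately show ?thesis by (simp add: ab sum.delta del: sum.lessThan_Suc)
qed

lemma computable_fst_prod_decode:
  assumes "computable n a"
  shows "computable n (\<lambda>xs. fst (prod_decode (a xs)))"
  unfolding fst_prod_decode_sum
  using assms computable_tl[OF assms] computable_tl[OF computable_tl[OF assms]]
  by (intro computable_intros computable_prod_encode)

lemma computable_snd_prod_decode:
  assumes "computable n a"
  shows "computable n (\<lambda>xs. snd (prod_decode (a xs)))"
  unfolding snd_prod_decode_sum
  using assms computable_tl[OF assms] computable_tl[OF computable_tl[OF assms]]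
  by (intro computable_intros computable_prod_encode)

lemma computable_comp1:
  assumes "computable 1 (\<lambda>v. F (hd v))" "computable n a"
  shows "computable n (\<lambda>xs. F (a xs))"
  using computable_comp_list[of "[a]" "\<lambda>v. F (hd v)" n] assms by simp

lemma computable_comp2:
  assumes "computable (Suc (Suc 0)) (\<lambda>v. F (hd v) (hd (tl v)))" "computable n a" "computable n b"
  shows "computable n (\<lambda>xs. F (a xs) (b xs))"
  using computable_comp_list[of "[a, b]" "\<lambda>v. F (hd v) (hd (tl v))" n] assms
  by auto

lemma decidable_comp4:
  assumes "decidable (Suc (Suc (Suc (Suc 0)))) (\<lambda>v. F (hd v) (hd (tl v)) (hd (tl (tl v))) (hd (tl (tl (tl v)))))"
    "computable n a" "computable n b" "computable n c" "computable n d"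
  shows "decidable n (\<lambda>xs. F (a xs) (b xs) (c xs) (d xs))"
  using computable_comp_list[of "[a, b, c, d]"
      "\<lambda>v. of_bool (F (hd v) (hd (tl v)) (hd (tl (tl v))) (hd (tl (tl (tl v)))))" n]
    assms by (auto simp: decidable_def)

subsection \<open>Binary representation\<close>

lemma bit_nat_imp_exp_le: "bit (m::nat) k \<Longrightarrow> 2 ^ k \<le> m"
  by (metis bit_iff_odd div_less even_zero not_le)

lemma bit_add_exp:
  assumes "m < (2::nat) ^ b"
  shows "bit (m + 2 ^ b) k \<longleftrightarrow> k = b \<or> bit m k"
proof -
  have "\<not> bit m b" using assms bit_nat_imp_exp_le[of m b] by auto
  then have "and m (2 ^ b) = 0"
    by (intro bit_eqI) (auto simp: bit_and_iff bit_exp_iff)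
  then have "m + 2 ^ b = or m (2 ^ b)" by (rule disjunctive_add_eq_or)
  then show ?thesis by (auto simp: bit_or_iff bit_exp_iff)
qed

text \<open>A finite set of numbers below \<open>b\<close> is stored as a single number, so that
  whole sets can serve as values in a primitive recursion.\<close>

definition bits_below :: "nat \<Rightarrow> (nat \<Rightarrow> bool) \<Rightarrow> nat" where
  "bits_below b P = (\<Sum>k<b. of_bool (P k) * 2 ^ k)"

lemma bits_below_less: "bits_below b P < 2 ^ b"
  by (induction b) (auto simp: bits_below_def)

lemma bit_bits_below: "bit (bits_below b P) k \<longleftrightarrow> k < b \<and> P k"
proof (induction b)
  case (Suc b)
  then show ?case
    using bit_add_exp[OF bits_below_less[of b P], of k]
    by (auto simp: bits_below_def less_Suc_eq)
qed (simp add: bits_below_def)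

lemma computable_bits_below:
  assumes "computable n b" "decidable (Suc n) (\<lambda>ys. P (hd ys) (tl ys))"
  shows "computable n (\<lambda>xs. bits_below (b xs) (\<lambda>k. P k xs))"
  unfolding bits_below_def using assms by (intro computable_intros)

lemma bit_less: "bit (n::nat) k \<Longrightarrow> k < n"
  using bit_nat_imp_exp_le less_exp less_le_trans by blast

lemma finite_bits: "finite {k. bit (n::nat) k}"
  by (rule finite_subset[of _ "{..<n}"]) (auto simp: bit_less)

lemma bits_nonempty: "0 < n \<Longrightarrow> {k. bit (n::nat) k} \<noteq> {}"
  using bit_eqI[of n 0] by auto

lemma bit_mu: "0 < n \<Longrightarrow> bit n (mu n)"
  unfolding mu_def using Max_in[OF finite_bits bits_nonempty] by auto

lemma bit_lam: "0 < n \<Longrightarrow> bit n (lam n)"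
  unfolding lam_def using Min_in[OF finite_bits bits_nonempty] by auto

lemma bit_le_mu: "bit n k \<Longrightarrow> k \<le> mu n"
  unfolding mu_def by (intro Max_ge finite_bits) simp

lemma lam_le_bit: "bit n k \<Longrightarrow> lam n \<le> k"
  unfolding lam_def by (intro Min_le finite_bits) simp

lemma mu_eqI: "bit n k \<Longrightarrow> (\<And>k'. bit n k' \<Longrightarrow> k' \<le> k) \<Longrightarrow> mu n = k"
  unfolding mu_def by (rule Max_eqI) (auto simp: finite_bits)

lemma lam_eqI: "bit n k \<Longrightarrow> (\<And>k'. bit n k' \<Longrightarrow> k \<le> k') \<Longrightarrow> lam n = k"
  unfolding lam_def by (rule Min_eqI) (auto simp: finite_bits)

lemma less_exp_mu: "n < 2 ^ Suc (mu n)"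
proof -
  have "take_bit (Suc (mu n)) n = n"
    by (rule bit_eqI) (auto simp: bit_take_bit_iff dest: bit_le_mu)
  then show ?thesis using take_bit_nat_less_exp[of "Suc (mu n)" n] by simp
qed

text \<open>Replaces \<open>mu\<close>, defined by a maximum, by an arithmetic test that is visibly
  decidable; \<open>wins\<close> and \<open>color\<close> use this form.\<close>

lemma div_exp_eq_1_iff: "n div 2 ^ t = 1 \<longleftrightarrow> 0 < n \<and> mu n = t"
proof
  assume *: "n div 2 ^ t = 1"
  then have "bit n t" by (simp add: bit_iff_odd)
  moreover have "n < 2 ^ Suc t" using * div_less_iff_less_mult[of "2 ^ t" n 2] by simp
  then have "k' \<le> t" if "bit n k'" for k'
    using bit_nat_imp_exp_le[OF that] power_less_imp_less_exp[of "2::nat" k' "Suc t"] by simp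
  moreover have "0 < n" using * by (cases n) auto
  ultimately show "0 < n \<and> mu n = t" using mu_eqI by blast
next
  assume "0 < n \<and> mu n = t"
  then show "n div 2 ^ t = 1"
    using bit_nat_imp_exp_le[OF bit_mu, of n] less_exp_mu[of n] by (intro div_nat_eqI) auto
qed

lemma bit_add_apart:
  assumes "0 < v" "mu x < lam v"
  shows "bit (x + v) k \<longleftrightarrow> bit x k \<or> bit v k"
proof -
  have "and x v = 0"
    by (rule bit_eqI) (use assms in \<open>auto simp: bit_and_iff dest!: bit_le_mu[of x] lam_le_bit[of v]\<close>)
  then have "x + v = or x v" by (rule disjunctive_add_eq_or)
  then show ?thesis by (simp add: bit_or_iff)
qed

lemma mu_lam_add:
  assumes "0 < x" "0 < v" "mu x < lam v"
  shows "mu (x + v) = mu v" "lam (x + v) = lam x"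
proof -
  have "lam v \<le> mu v" using assms bit_mu lam_le_bit by blast
  then show "mu (x + v) = mu v"
    using assms bit_mu[of v]
    by (intro mu_eqI) (auto simp: bit_add_apart dest: bit_le_mu[of x] bit_le_mu[of v])
  have "lam x \<le> mu x" using assms bit_mu lam_le_bit by blast
  then show "lam (x + v) = lam x"
    using assms bit_lam[of x]
    by (intro lam_eqI) (auto simp: bit_add_apart dest: lam_le_bit[of x] lam_le_bit[of v])
qed

lemma ll_iff: "0 < y \<Longrightarrow> x \<lless> y \<longleftrightarrow> mu x < lam y"
proof -
  assume y: "0 < y"
  have "x < y" if "mu x < lam y"
  proof -
    have "x < 2 ^ Suc (mu x)" by (rule less_exp_mu)
    also have "\<dots> \<le> 2 ^ lam y" using that by (intro power_increasing) auto
    also have "\<dots> \<le> y" using bit_nat_imp_exp_le bit_lam y by blast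
    finally show ?thesis .
  qed
  then show ?thesis unfolding ll_def by blast
qed

subsection \<open>A universal evaluator by stages\<close>

abbreviation pair :: "nat \<Rightarrow> nat \<Rightarrow> nat" where "pair a b \<equiv> prod_encode (a, b)"
abbreviation pi1 :: "nat \<Rightarrow> nat" where "pi1 k \<equiv> fst (prod_decode k)"
abbreviation pi2 :: "nat \<Rightarrow> nat" where "pi2 k \<equiv> snd (prod_decode k)"
abbreviation lcons :: "nat \<Rightarrow> nat \<Rightarrow> nat" where "lcons a l \<equiv> Suc (pair a l)"
abbreviation lhd :: "nat \<Rightarrow> nat" where "lhd l \<equiv> pi1 (l - 1)"
abbreviation ltl :: "nat \<Rightarrow> nat" where "ltl l \<equiv> pi2 (l - 1)"
abbreviation judg :: "nat \<Rightarrow> nat \<Rightarrow> nat \<Rightarrow> nat" where "judg f xs z \<equiv> pair f (pair xs z)"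

fun recf_code :: "recf \<Rightarrow> nat" where
  "recf_code Zero = pair 0 0"
| "recf_code Succ = pair 1 0"
| "recf_code (Proj i) = pair 2 i"
| "recf_code (Comp f gs) = pair 3 (pair (recf_code f) (list_encode (map recf_code gs)))"
| "recf_code (Prec f g) = pair 4 (pair (recf_code f) (recf_code g))"
| "recf_code (Mini f) = pair 5 (recf_code f)"

text \<open>
  A judgment \<open>judg f xs z\<close> says that program \<open>f\<close> maps \<open>xs\<close> to \<open>z\<close>.  Two auxiliary kinds of programs
  break the rules for composition and minimization into steps with boundedly many premises:
  tag 6 evaluates a list of programs, and \<open>pair 7 f\<close> maps \<open>xs\<close> to every \<open>n\<close> such that \<open>f\<close> is
  nonzero at all \<open>m # xs\<close> with \<open>m < n\<close>.
\<close>

definition step :: "nat \<Rightarrow> nat \<Rightarrow> nat \<Rightarrow> nat \<Rightarrow> nat \<Rightarrow> nat \<Rightarrow> bool" where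
  "step s E h a xs z \<longleftrightarrow>
     h = 0 \<and> z = 0 \<or>
     h = 1 \<and> 0 < xs \<and> z = Suc (lhd xs) \<or>
     h = 2 \<and> 0 < xs \<and> (a = 0 \<and> z = lhd xs \<or> 0 < a \<and> bit E (judg (pair 2 (a - 1)) (ltl xs) z)) \<or>
     h = 3 \<and> (\<exists>ys<s. bit E (judg (pair 6 (pi2 a)) xs ys) \<and> bit E (judg (pi1 a) ys z)) \<or>
     h = 4 \<and> 0 < xs \<and>
       (lhd xs = 0 \<and> bit E (judg (pi1 a) (ltl xs) z) \<or>
        0 < lhd xs \<and> (\<exists>y<s. bit E (judg (pair 4 a) (lcons (lhd xs - 1) (ltl xs)) y) \<and>
          bit E (judg (pi2 a) (lcons y (lcons (lhd xs - 1) (ltl xs))) z))) \<or>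
     h = 5 \<and> bit E (judg (pair 7 a) xs z) \<and> bit E (judg a (lcons z xs) 0) \<or>
     h = 6 \<and> (a = 0 \<and> z = 0 \<or> 0 < a \<and> 0 < z \<and> bit E (judg (lhd a) xs (lhd z)) \<and>
       bit E (judg (pair 6 (ltl a)) xs (ltl z))) \<or>
     h = 7 \<and> (z = 0 \<or> 0 < z \<and> bit E (judg (pair 7 a) xs (z - 1)) \<and>
       (\<exists>y<s. bit E (judg a (lcons (z - 1) xs) (Suc y))))"

text \<open>The bits of \<open>stage s\<close> are codes of derived judgments, all below
  \<open>s\<close>. With the searches in \<open>step\<close> also bounded by \<open>s\<close>, each
  stage is computed from the previous one by bounded operations.\<close>

primrec stage :: "nat \<Rightarrow> nat" where
  "stage 0 = 0"
| "stage (Suc s) = bits_below (Suc s) (\<lambda>k. bit (stage s) k \<or>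
     step s (stage s) (pi1 (pi1 k)) (pi2 (pi1 k)) (pi1 (pi2 k)) (pi2 (pi2 k)))"

declare stage.simps(2) [simp del]

lemma computable_stage: "computable n a \<Longrightarrow> computable n (\<lambda>xs. stage (a xs))"
proof (rule computable_comp1[where F = stage])
  have "stage k = rec_nat 0 (\<lambda>s E. bits_below (Suc s) (\<lambda>k. bit E k \<or>
     step s E (pi1 (pi1 k)) (pi2 (pi1 k)) (pi1 (pi2 k)) (pi2 (pi2 k)))) k" for k
    by (induction k) (auto simp: stage.simps(2))
  then show "computable 1 (\<lambda>v. stage (hd v))"
    unfolding step_def One_nat_def
    by (simp only:) (intro computable_rec_nat computable_bits_below computable_intros
        computable_prod_encode computable_fst_prod_decode computable_snd_prod_decode)
qed

lemma bit_stage_less: "bit (stage s) k \<Longrightarrow> k < s"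
  by (cases s) (auto simp: bit_bits_below stage.simps(2))

lemma bit_stage_Suc:
  "bit (stage (Suc s)) (judg (pair h a) xs z) \<longleftrightarrow>
     judg (pair h a) xs z < Suc s \<and>
     (bit (stage s) (judg (pair h a) xs z) \<or> step s (stage s) h a xs z)"
  by (simp add: bit_bits_below stage.simps(2))

section \<open>Monotonicity and soundness of the stages\<close>

lemma bit_stage_mono:
  assumes "bit (stage s) k" "s \<le> s'"
  shows "bit (stage s') k"
  using assms(2,1)
  by (induction s' rule: dec_induct) (auto simp: bit_bits_below stage.simps(2) dest: bit_stage_less)

text \<open>A new bit arises from one rule whose premises lie in the previous stage. Since ordinary
  judgments and those with tags 6 and 7 occur as premises of each other, the three claims need a
  joint induction.\<close>

lemma stage_sound_aux:
  "(\<forall>t xs z. bit (stage s) (judg (recf_code t) (list_encode xs) z) \<longrightarrow> eval t xs z) \<and>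
   (\<forall>gs xs zs. bit (stage s) (judg (pair 6 (list_encode (map recf_code gs))) (list_encode xs) (list_encode zs))
      \<longrightarrow> length zs = length gs \<and> (\<forall>i<length gs. eval (gs ! i) xs (zs ! i))) \<and>
   (\<forall>f xs n. bit (stage s) (judg (pair 7 (recf_code f)) (list_encode xs) n)
      \<longrightarrow> (\<forall>m<n. \<exists>y. eval f (m # xs) y \<and> y \<noteq> 0))"
proof (induction s)
  case 0
  show ?case by simp
next
  case (Suc s)
  note Suc1 = Suc[THEN conjunct1, rule_format]
    and Suc2 = Suc[THEN conjunct2, THEN conjunct1, rule_format]
    and Suc3 = Suc[THEN conjunct2, THEN conjunct2, rule_format]
  \<comment> \<open>\<open>list_encode\<close> is onto, so an intermediate value found by the search
    in \<open>step\<close> always codes an argument list.\<close>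
  have lists: "\<exists>ys. y = list_encode ys" for y by (metis list_decode_inverse)
  show ?case
  proof (intro conjI allI impI)
    fix t xs z
    assume *: "bit (stage (Suc s)) (judg (recf_code t) (list_encode xs) z)"
    show "eval t xs z"
    proof (cases "bit (stage s) (judg (recf_code t) (list_encode xs) z)")
      case True
      then show ?thesis by (rule Suc1)
    next
      case False
      show ?thesis
      proof (cases t)
        case Zero
        then show ?thesis using * False by (auto simp: bit_stage_Suc step_def intro: eval_Zero)
      next
        case Succ
        then show ?thesis using * False
          by (cases xs) (auto simp: bit_stage_Suc step_def intro: eval_Succ)
      next
        case (Proj i)
        then obtain x l where xs: "xs = x # l"
          using * False by (cases xs) (auto simp: bit_stage_Suc step_def)
        show ?thesis
        proof (cases i)
          case 0
          then show ?thesis using * False Proj xs eval_Proj[of 0 xs]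
            by (auto simp: bit_stage_Suc step_def)
        next
          case (Suc k)
          then have "bit (stage s) (judg (recf_code (Proj k)) (list_encode l) z)"
            using * False Proj xs by (auto simp: bit_stage_Suc step_def)
          then have "eval (Proj k) l z" by (rule Suc1)
          then have "k < length l" "z = l ! k" by (cases, simp)+
          then show ?thesis using Proj xs Suc eval_Proj[of i xs] by auto
        qed
      next
        case (Comp f gs)
        then obtain y where y: "bit (stage s) (judg (pair 6 (list_encode (map recf_code gs))) (list_encode xs) y)"
            "bit (stage s) (judg (recf_code f) y z)"
          using * False by (auto simp: bit_stage_Suc step_def)
        obtain ys where ys: "y = list_encode ys" using lists by blast
        show ?thesis
          using Suc2[OF y(1)[unfolded ys]] Suc1[OF y(2)[unfolded ys]] Comp
          by (auto intro: eval_Comp)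
      next
        case (Prec f g)
        then obtain n l where xs: "xs = n # l"
          using * False by (cases xs) (auto simp: bit_stage_Suc step_def)
        show ?thesis
        proof (cases n)
          case 0
          then have "bit (stage s) (judg (recf_code f) (list_encode l) z)"
            using * False Prec xs by (auto simp: bit_stage_Suc step_def)
          then show ?thesis using Suc1 Prec xs 0 by (auto intro: eval_Prec0)
        next
          case (Suc k)
          then obtain y where y: "bit (stage s) (judg (recf_code (Prec f g)) (list_encode (k # l)) y)"
            "bit (stage s) (judg (recf_code g) (list_encode (y # k # l)) z)"
            using * False Prec xs by (auto simp: bit_stage_Suc step_def)
          show ?thesis using Suc1[OF y(1)] Suc1[OF y(2)] Prec xs Suc by (auto intro: eval_PrecS)
        qed
      next
        case (Mini f)
        then have m: "bit (stage s) (judg (pair 7 (recf_code f)) (list_encode xs) z)"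
          "bit (stage s) (judg (recf_code f) (list_encode (z # xs)) 0)"
          using * False by (auto simp: bit_stage_Suc step_def)
        show ?thesis using Suc1[OF m(2)] Suc3[OF m(1)] Mini by (auto intro!: eval_Mini)
      qed
    qed
  next
    fix gs xs zs
    assume *: "bit (stage (Suc s)) (judg (pair 6 (list_encode (map recf_code gs))) (list_encode xs) (list_encode zs))"
    have "length zs = length gs \<and> (\<forall>i<length gs. eval (gs ! i) xs (zs ! i))"
    proof (cases "bit (stage s) (judg (pair 6 (list_encode (map recf_code gs))) (list_encode xs) (list_encode zs))")
      case True
      then show ?thesis by (rule Suc2)
    next
      case False
      show ?thesis
      proof (cases gs)
        case Nil
        then have "list_encode zs = list_encode []" using * False by (auto simp: bit_stage_Suc step_def)
        then show ?thesis using Nil by (simp only: list_encode_eq) simp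
      next
        case (Cons g gs')
        then obtain z zs' where zs: "zs = z # zs'"
          using * False by (cases zs) (auto simp: bit_stage_Suc step_def)
        then have "bit (stage s) (judg (recf_code g) (list_encode xs) z)"
          "bit (stage s) (judg (pair 6 (list_encode (map recf_code gs'))) (list_encode xs) (list_encode zs'))"
          using * False Cons by (auto simp: bit_stage_Suc step_def)
        then show ?thesis using Suc1 Suc2[of gs' xs zs'] Cons zs by (auto simp: nth_Cons split: nat.split)
      qed
    qed
    then show "length zs = length gs" "\<And>i. i < length gs \<Longrightarrow> eval (gs ! i) xs (zs ! i)" by auto
  next
    fix f xs n m
    assume *: "bit (stage (Suc s)) (judg (pair 7 (recf_code f)) (list_encode xs) n)" and m: "m < n"
    show "\<exists>y. eval f (m # xs) y \<and> y \<noteq> 0"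
    proof (cases "bit (stage s) (judg (pair 7 (recf_code f)) (list_encode xs) n)")
      case True
      then show ?thesis using m by (rule Suc3)
    next
      case False
      obtain k where n: "n = Suc k" using m by (cases n) auto
      then obtain y where y: "bit (stage s) (judg (pair 7 (recf_code f)) (list_encode xs) k)"
        "bit (stage s) (judg (recf_code f) (list_encode (k # xs)) (Suc y))"
        using * False by (auto simp: bit_stage_Suc step_def)
      show ?thesis
      proof (cases "m = k")
        case True
        then show ?thesis using Suc1[OF y(2)] by auto
      next
        case False
        then show ?thesis using Suc3[OF y(1)] m n by auto
      qed
    qed
  qed
qed

lemma stage_sound: "bit (stage s) (judg (recf_code t) (list_encode xs) z) \<Longrightarrow> eval t xs z"
  using stage_sound_aux by blast

text \<open>Stages are monotone, so "eventually" means the same as "at some stage", but it lets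
  several premises be brought to a common stage directly.\<close>

definition enumerated :: "nat \<Rightarrow> bool" where
  "enumerated k \<longleftrightarrow> (\<forall>\<^sub>F s in sequentially. bit (stage s) k)"

lemma enumeratedI:
  assumes "\<forall>\<^sub>F s in sequentially. step s (stage s) h a xs z"
  shows "enumerated (judg (pair h a) xs z)"
proof -
  have "\<forall>\<^sub>F s in sequentially. bit (stage (Suc s)) (judg (pair h a) xs z)"
    using assms eventually_gt_at_top[of "judg (pair h a) xs z"]
    by eventually_elim (simp add: bit_stage_Suc)
  then show ?thesis unfolding enumerated_def by (subst (asm) eventually_sequentially_Suc)
qed

lemma enumeratedD:
  "enumerated (judg f xs z) \<Longrightarrow> \<forall>\<^sub>F s in sequentially. bit (stage s) (judg f xs z) \<and> z < s"
  unfolding enumerated_def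
  by (erule eventually_mono)
    (meson bit_stage_less le_less_trans le_prod_encode_2 le_trans)

section \<open>Completeness of the stages and determinism of evaluation\<close>

lemma enumerated_list:
  assumes "length ys = length gs" "\<forall>i<length gs. enumerated (judg (recf_code (gs ! i)) xs (ys ! i))"
  shows "enumerated (judg (pair 6 (list_encode (map recf_code gs))) xs (list_encode ys))"
  using assms
proof (induction ys gs rule: list_induct2)
  case Nil
  show ?case by (rule enumeratedI) (simp add: step_def)
next
  case (Cons y ys g gs)
  have "enumerated (judg (recf_code g) xs y)"
    "enumerated (judg (pair 6 (list_encode (map recf_code gs))) xs (list_encode ys))"
    using Cons.prems[rule_format, of 0] Cons.prems[rule_format, of "Suc _"] Cons.IH by auto
  then have "\<forall>\<^sub>F s in sequentially. step s (stage s) 6 (list_encode (map recf_code (g # gs))) xs (list_encode (y # ys))"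
    unfolding enumerated_def by eventually_elim (simp add: step_def)
  then show ?case by (rule enumeratedI)
qed

lemma enumerated_search:
  assumes "\<forall>m<n. \<exists>y. enumerated (judg f (lcons m xs) y) \<and> y \<noteq> 0"
  shows "enumerated (judg (pair 7 f) xs n)"
  using assms
proof (induction n)
  case 0
  show ?case by (rule enumeratedI) (simp add: step_def)
next
  case (Suc n)
  then obtain y where "enumerated (judg f (lcons n xs) (Suc y))" "enumerated (judg (pair 7 f) xs n)"
    by (metis less_Suc_eq not0_implies_Suc)
  from enumeratedD[OF this(1)] this(2)[unfolded enumerated_def]
  have "\<forall>\<^sub>F s in sequentially. step s (stage s) 7 f xs (Suc n)"
    by eventually_elim (auto simp: step_def intro!: exI[of _ y])
  then show ?case by (rule enumeratedI)
qed

lemma stage_complete: "eval t xs z \<Longrightarrow> enumerated (judg (recf_code t) (list_encode xs) z)"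
proof (induction rule: eval.induct)
  case (eval_Zero xs)
  show ?case by (simp, rule enumeratedI) (simp add: step_def)
next
  case (eval_Succ x xs)
  show ?case unfolding recf_code.simps by (rule enumeratedI) (simp add: step_def)
next
  case (eval_Proj i xs)
  then show ?case
  proof (induction i arbitrary: xs)
    case 0
    then obtain x l where "xs = x # l" by (cases xs) auto
    then show ?case unfolding recf_code.simps by (intro enumeratedI) (simp add: step_def)
  next
    case (Suc i)
    then obtain x l where xs: "xs = x # l" by (cases xs) auto
    then have "enumerated (judg (recf_code (Proj i)) (list_encode l) (l ! i))" using Suc by simp
    then have "\<forall>\<^sub>F s in sequentially. step s (stage s) 2 (Suc i) (list_encode xs) (xs ! Suc i)"
      unfolding enumerated_def by eventually_elim (simp add: step_def xs)
    then show ?case unfolding recf_code.simps by (rule enumeratedI)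
  qed
next
  case (eval_Comp ys gs xs f z)
  then have "enumerated (judg (pair 6 (list_encode (map recf_code gs))) (list_encode xs) (list_encode ys))"
    by (intro enumerated_list) auto
  from enumeratedD[OF this] eval_Comp.IH(2)[unfolded enumerated_def]
  have "\<forall>\<^sub>F s in sequentially. step s (stage s) 3 (pair (recf_code f) (list_encode (map recf_code gs))) (list_encode xs) z"
    by eventually_elim (auto simp: step_def)
  then show ?case unfolding recf_code.simps by (rule enumeratedI)
next
  case (eval_Prec0 f xs z g)
  from eval_Prec0.IH
  have "\<forall>\<^sub>F s in sequentially. step s (stage s) 4 (pair (recf_code f) (recf_code g)) (list_encode (0 # xs)) z"
    unfolding enumerated_def by eventually_elim (simp add: step_def)
  then show ?case unfolding recf_code.simps by (rule enumeratedI)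
next
  case (eval_PrecS f g n xs y z)
  from enumeratedD[OF eval_PrecS.IH(1)] eval_PrecS.IH(2)[unfolded enumerated_def]
  have "\<forall>\<^sub>F s in sequentially. step s (stage s) 4 (pair (recf_code f) (recf_code g)) (list_encode (Suc n # xs)) z"
    by eventually_elim (auto simp: step_def)
  then show ?case unfolding recf_code.simps by (rule enumeratedI)
next
  case (eval_Mini f n xs)
  then have "enumerated (judg (pair 7 (recf_code f)) (list_encode xs) n)"
    by (intro enumerated_search) auto
  from this[unfolded enumerated_def] eval_Mini.IH(1)[unfolded enumerated_def]
  have "\<forall>\<^sub>F s in sequentially. step s (stage s) 5 (recf_code f) (list_encode xs) n"
    by eventually_elim (simp add: step_def)
  then show ?case unfolding recf_code.simps by (rule enumeratedI)
qed

text \<open>Needed to conclude from an accepted value 1 that the decided relation holds. For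
  minimization, the smaller of two distinct results would give the inner program both a zero and a
  nonzero value.\<close>

lemma eval_deterministic: "eval t xs z \<Longrightarrow> eval t xs z' \<Longrightarrow> z = z'"
proof (induction arbitrary: z' rule: eval.induct)
  case (eval_Comp ys gs xs f z)
  from eval_Comp.prems obtain ys' where ys': "length ys' = length gs"
    "\<forall>i<length gs. eval (gs ! i) xs (ys' ! i)" "eval f ys' z'"
    by cases auto
  then have "ys = ys'" using eval_Comp.hyps(1) eval_Comp.IH(1) by (auto intro: nth_equalityI)
  then show ?case using eval_Comp.IH(2) ys'(3) by blast
next
  case (eval_PrecS f g n xs y z)
  from eval_PrecS.prems obtain y' where "eval (Prec f g) (n # xs) y'" "eval g (y' # n # xs) z'"
    by cases auto
  then show ?case using eval_PrecS.IH by metis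
next
  case (eval_Mini f n xs)
  from eval_Mini.prems have "eval f (z' # xs) 0" "\<forall>m<z'. \<exists>y. eval f (m # xs) y \<and> y \<noteq> 0"
    by (cases, simp)+
  then show ?case using eval_Mini.IH by (metis linorder_neqE_nat)
next
  case (eval_Zero xs)
  then show ?case by cases simp
next
  case (eval_Succ x xs)
  then show ?case by cases simp
next
  case (eval_Proj i xs)
  from eval_Proj(2) show ?case by cases simp
next
  case (eval_Prec0 f xs z g)
  from eval_Prec0.prems show ?case by cases (rule eval_Prec0.IH)
qed

subsection \<open>The coloring\<close>

type_synonym rel5 = "nat \<Rightarrow> nat \<Rightarrow> nat \<Rightarrow> nat \<Rightarrow> nat \<Rightarrow> bool"

text \<open>
  \<open>G e v x a b\<close> stands for the \<open>\<Sigma>\<^sub>1\<close> matrix of \<open>\<exists>a. \<forall>b. G e v x a b\<close>, which asserts \<open>x \<in> A\<close> for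
  \<open>v = 1\<close> and \<open>x \<notin> A\<close> for \<open>v = 0\<close>, where \<open>A\<close> is the \<open>e\<close>-th set.  Stage \<open>j\<close> believes the claim
  with the smaller witness \<open>a\<close> that is confirmed for all \<open>b < j\<close>.
\<close>

definition good :: "rel5 \<Rightarrow> nat \<Rightarrow> nat \<Rightarrow> nat \<Rightarrow> nat \<Rightarrow> nat \<Rightarrow> bool" where
  "good G e v x j a \<longleftrightarrow> (\<forall>b<j. G e v x a b)"

definition approx :: "rel5 \<Rightarrow> nat \<Rightarrow> nat \<Rightarrow> nat \<Rightarrow> bool" where
  "approx G e j x \<longleftrightarrow> (\<exists>a<j. good G e 1 x j a \<and> (\<forall>a'<Suc a. \<not> good G e 0 x j a'))"

definition claims :: "rel5 \<Rightarrow> nat \<Rightarrow> nat \<Rightarrow> nat \<Rightarrow> bool" where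
  "claims G e j x \<longleftrightarrow> approx G e j x \<and> (\<Sum>y<x. of_bool (approx G e j y)) < (2::nat) ^ e"

definition adjacent :: "nat \<Rightarrow> nat \<Rightarrow> nat \<Rightarrow> bool" where
  "adjacent n i j \<longleftrightarrow> i < j \<and> bit n i \<and> bit n j \<and> (\<forall>k<j. i < k \<longrightarrow> \<not> bit n k)"

definition marks :: "nat \<Rightarrow> nat \<Rightarrow> nat" where
  "marks H n = (\<Sum>i<n. \<Sum>j<n. of_bool (adjacent n i j \<and> bit H (pair i j)))"

text \<open>\<open>H\<close> is the table of marks decided so far. The tests
  \<open>x div 2 ^ i = 1\<close> express \<open>mu x = i\<close> within a bounded search; the bound
  \<open>e < j\<close> excludes any fixed \<open>e\<close> from only finitely many
  \<open>j\<close>.\<close>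

definition wins :: "rel5 \<Rightarrow> nat \<Rightarrow> nat \<Rightarrow> nat \<Rightarrow> bool" where
  "wins G H i j \<longleftrightarrow> i < j \<and> (\<exists>e<j.
     (\<exists>x<2 ^ Suc i. x div 2 ^ i = 1 \<and> claims G e j x \<and> even (marks H x)) \<and>
     (\<forall>e'<e. \<forall>x<2 ^ Suc i. x div 2 ^ i = 1 \<longrightarrow> \<not> claims G e' j x))"

text \<open>
  The marks are tabulated in the order of the codes \<open>pair i j\<close>: deciding \<open>(i, j)\<close> only requires
  the earlier pairs with both components at most \<open>i\<close>.
\<close>

primrec table :: "rel5 \<Rightarrow> nat \<Rightarrow> nat" where
  "table G 0 = 0"
| "table G (Suc k) = table G k + of_bool (wins G (table G k) (pi1 k) (pi2 k)) * 2 ^ k"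

definition marked :: "rel5 \<Rightarrow> nat \<Rightarrow> nat \<Rightarrow> bool" where
  "marked G i j \<longleftrightarrow> wins G (table G (pair i j)) i j"

definition weight :: "rel5 \<Rightarrow> nat \<Rightarrow> nat" where
  "weight G n = card {(i, j). adjacent n i j \<and> marked G i j}"

definition accepts_by :: "nat \<Rightarrow> nat \<Rightarrow> nat \<Rightarrow> nat \<Rightarrow> nat \<Rightarrow> nat \<Rightarrow> bool" where
  "accepts_by t e v x a b \<longleftrightarrow> (\<exists>d<t. bit (stage t) (judg e (list_encode [v, x, a, b, d]) 1))"

definition accepts :: "nat \<Rightarrow> nat \<Rightarrow> nat \<Rightarrow> nat \<Rightarrow> nat \<Rightarrow> bool" where
  "accepts e v x a b \<longleftrightarrow> (\<exists>t. accepts_by t e v x a b)"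

text \<open>The only contributing \<open>t\<close> is \<open>\<mu> n\<close>, which makes the stage the same for \<open>w\<^sub>1 + w\<^sub>2\<close> and \<open>x + w\<^sub>1 + w\<^sub>2\<close>.\<close>

definition color :: "nat \<Rightarrow> nat" where
  "color n = (\<Sum>t<n. of_bool (n div 2 ^ t = 1 \<and> odd (marks (table (accepts_by t) (pair n n)) n)))"

subsection \<open>Computability of the coloring\<close>

text \<open>Each layer is proved decidable once in plain variables; later layers use it through
  substitution instead of unfolding it.\<close>

lemma decidable_approx:
  "decidable (Suc (Suc (Suc (Suc 0)))) (\<lambda>v. approx (accepts_by (hd v)) (hd (tl v)) (hd (tl (tl v))) (hd (tl (tl (tl v)))))"
  unfolding approx_def good_def accepts_by_def list_encode.simps
  by (intro computable_intros computable_stage computable_prod_encode)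

lemmas decidable_approx_comp = decidable_comp4[where F = "\<lambda>t. approx (accepts_by t)", OF decidable_approx]

lemma decidable_claims:
  "decidable (Suc (Suc (Suc (Suc 0)))) (\<lambda>v. claims (accepts_by (hd v)) (hd (tl v)) (hd (tl (tl v))) (hd (tl (tl (tl v)))))"
  unfolding claims_def
  by (intro computable_intros decidable_approx_comp)

lemmas decidable_claims_comp = decidable_comp4[where F = "\<lambda>t. claims (accepts_by t)", OF decidable_claims]

lemma computable_marks: "computable (Suc (Suc 0)) (\<lambda>v. marks (hd v) (hd (tl v)))"
  unfolding marks_def adjacent_def
  by (intro computable_intros computable_prod_encode)

lemmas computable_marks_comp = computable_comp2[where F = marks, OF computable_marks]

lemma computable_table: "computable (Suc (Suc 0)) (\<lambda>v. table (accepts_by (hd v)) (hd (tl v)))"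
proof -
  have "table G k = rec_nat 0 (\<lambda>k H. H + of_bool (wins G H (pi1 k) (pi2 k)) * 2 ^ k) k" for G k
    by (induction k) auto
  then show ?thesis
    unfolding wins_def
    by (simp only:) (intro computable_rec_nat computable_intros decidable_even
        decidable_claims_comp computable_marks_comp
        computable_fst_prod_decode computable_snd_prod_decode)
qed

lemmas computable_table_comp =
  computable_comp2[where F = "\<lambda>t. table (accepts_by t)", OF computable_table]

lemma recursive_color: "recursive_fun color"
proof -
  have "computable 1 (\<lambda>v. color (hd v))"
    unfolding color_def One_nat_def
    by (intro computable_intros decidable_even computable_table_comp computable_marks_comp
        computable_prod_encode)
  then obtain t where "\<And>xs. length xs = 1 \<Longrightarrow> eval t xs (color (hd xs))"
    unfolding computable_def by auto
  from this[of "[_]"] show ?thesis unfolding recursive_fun_def by auto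
qed

subsection \<open>Marked pairs\<close>

lemma finite_adjacent: "finite {(i, j). adjacent n i j \<and> P i j}"
  by (rule finite_subset[of _ "{k. bit n k} \<times> {k. bit n k}"])
    (auto simp: adjacent_def finite_bits)

lemma adjacent_add:
  assumes "0 < x" "0 < v" "mu x < lam v"
  shows "adjacent (x + v) i j \<longleftrightarrow> adjacent x i j \<or> adjacent v i j \<or> i = mu x \<and> j = lam v"
proof -
  note bits = bit_add_apart[OF assms(2,3)]
  have x: "bit x (mu x)" "\<And>k. bit x k \<Longrightarrow> k \<le> mu x" using assms bit_mu bit_le_mu by auto
  have v: "bit v (lam v)" "\<And>k. bit v k \<Longrightarrow> lam v \<le> k" using assms bit_lam lam_le_bit by auto
  \<comment> \<open>An adjacent pair that straddles the two blocks cannot jump over the top bit of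
    \<open>x\<close> or the bottom bit of \<open>v\<close>.\<close>
  have "i = mu x \<and> j = lam v" if *: "adjacent (x + v) i j" "bit x i" "bit v j"
  proof -
    have "i < j" and gap: "\<And>k. i < k \<Longrightarrow> k < j \<Longrightarrow> \<not> bit x k \<and> \<not> bit v k"
      using *(1) by (auto simp: adjacent_def bits)
    then show ?thesis
      using gap[of "mu x"] gap[of "lam v"] x(1) v(1) x(2)[OF *(2)] v(2)[OF *(3)] assms(3)
      by linarith
  qed
  moreover have "\<not> (bit v i \<and> bit x j)" if "i < j" using x(2)[of j] v(2)[of i] assms(3) that by auto
  ultimately have "adjacent x i j \<or> adjacent v i j \<or> i = mu x \<and> j = lam v" if "adjacent (x + v) i j"
    using that by (auto simp: adjacent_def bits)
  moreover have nv: "\<not> bit v k" if "k \<le> mu x" for k using v(2)[of k] assms(3) that by auto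
  moreover have nx: "\<not> bit x k" if "lam v \<le> k" for k using x(2)[of k] assms(3) that by auto
  moreover have "adjacent (x + v) i j" if "adjacent x i j"
    using that x(2)[of j] by (auto simp: adjacent_def bits nv)
  moreover have "adjacent (x + v) i j" if "adjacent v i j"
    using that v(2)[of i] by (auto simp: adjacent_def bits nx)
  moreover have "adjacent (x + v) (mu x) (lam v)"
    using x(1) v(1) assms(3) x(2) v(2) by (auto simp: adjacent_def bits simp flip: not_less)
  ultimately show ?thesis by blast
qed

lemma weight_add:
  assumes "0 < x" "0 < v" "mu x < lam v"
  shows "weight G (x + v) = weight G x + of_bool (marked G (mu x) (lam v)) + weight G v"
proof -
  let ?S = "\<lambda>n. {(i, j). adjacent n i j \<and> marked G i j}"
  let ?M = "{(i, j). i = mu x \<and> j = lam v \<and> marked G i j}"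
  have M: "?M = (if marked G (mu x) (lam v) then {(mu x, lam v)} else {})" by auto
  have "?S (x + v) = (?S x \<union> ?M) \<union> ?S v" using adjacent_add[OF assms] by auto
  moreover have "?S x \<inter> ?M = {}" "(?S x \<union> ?M) \<inter> ?S v = {}"
    using assms(3) by (auto simp: adjacent_def dest!: bit_le_mu[of x] lam_le_bit[of v])
  moreover have "finite (?S n)" for n by (rule finite_adjacent)
  moreover have "finite ?M" "card ?M = of_bool (marked G (mu x) (lam v))" unfolding M by auto
  ultimately show ?thesis unfolding weight_def by (simp add: card_Un_disjoint)
qed

lemma table_less: "table G k < 2 ^ k"
  by (induction k) auto

lemma bit_table: "bit (table G m) k \<longleftrightarrow> k < m \<and> marked G (pi1 k) (pi2 k)"
proof (induction m)
  case (Suc m)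
  then show ?case
    using bit_add_exp[OF table_less[of G m], of k] by (auto simp: less_Suc_eq marked_def)
qed simp

lemma marks_eq_card: "marks H n = card {(i, j). adjacent n i j \<and> bit H (pair i j)}"
proof -
  have "{(i, j). adjacent n i j \<and> bit H (pair i j)} =
    {..<n} \<times> {..<n} \<inter> {p. case p of (i, j) \<Rightarrow> adjacent n i j \<and> bit H (pair i j)}"
    by (auto simp: adjacent_def bit_less)
  then show ?thesis
    unfolding marks_def sum.cartesian_product
    by (simp add: split_def sum_of_bool_eq)
qed

text \<open>The pairing function runs through the diagonals of constant \<open>i + j\<close> in
  increasing order.\<close>

lemma prod_encode_less: "i + j < i' + j' \<Longrightarrow> pair i j < pair i' j'"
proof -
  assume "i + j < i' + j'"
  moreover have "triangle m \<le> triangle n" if "m \<le> n" for m n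
    using that by (induction n rule: dec_induct) auto
  ultimately have "triangle (Suc (i + j)) \<le> triangle (i' + j')" by (metis Suc_leI)
  then show ?thesis by (simp add: prod_encode_def)
qed

lemma marks_table:
  assumes "\<And>i j. adjacent n i j \<Longrightarrow> pair i j < m"
  shows "marks (table G m) n = weight G n"
  unfolding marks_eq_card weight_def bit_table by (rule arg_cong[of _ _ card]) (use assms in auto)

text \<open>This eliminates the table: pairs inside an \<open>x\<close> with \<open>mu x = i\<close>
  have components at most \<open>i < j\<close>, hence a smaller sum and a smaller code, so their
  marks are already tabulated.\<close>

lemma marked_iff:
  "marked G i j \<longleftrightarrow> i < j \<and> (\<exists>e<j.
     (\<exists>x>0. mu x = i \<and> claims G e j x \<and> even (weight G x)) \<and>
     (\<forall>e'<e. \<forall>x>0. mu x = i \<longrightarrow> \<not> claims G e' j x))"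
proof (cases "i < j")
  case True
  have 1: "marks (table G (pair i j)) x = weight G x" if "mu x = i" for x
  proof (rule marks_table)
    fix i' j' assume "adjacent x i' j'"
    then have "i' < j'" "j' \<le> i" using that bit_le_mu by (auto simp: adjacent_def)
    then show "pair i' j' < pair i j" using True by (intro prod_encode_less) auto
  qed
  have 2: "x < 2 ^ Suc i \<and> x div 2 ^ i = 1 \<longleftrightarrow> 0 < x \<and> mu x = i" for x
    using div_exp_eq_1_iff[of x i] less_exp_mu[of x] by auto
  have ex: "(\<exists>x<2 ^ Suc i. x div 2 ^ i = 1 \<and> P x) \<longleftrightarrow> (\<exists>x>0. mu x = i \<and> P x)" for P
    using 2 by metis
  have all: "(\<forall>x<2 ^ Suc i. x div 2 ^ i = 1 \<longrightarrow> P x) \<longleftrightarrow> (\<forall>x>0. mu x = i \<longrightarrow> P x)" for P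
    using 2 by metis
  show ?thesis unfolding marked_def wins_def ex all using 1 by metis
qed (simp add: marked_def wins_def)

lemma sum_of_bool_single: "(\<Sum>t<n. of_bool (t = k \<and> P t)) = (of_bool (k < n \<and> P k) :: nat)" for n :: nat
  by (induction n) (auto simp: less_Suc_eq simp del: sum_of_bool_eq)

lemma color_eq: "color n = of_bool (0 < n \<and> odd (weight (accepts_by (mu n)) n))"
proof (cases "n = 0")
  case False
  \<comment> \<open>All bits of \<open>n\<close> lie below \<open>n\<close>, so
    \<open>pair n n\<close> exceeds every code that matters.\<close>
  have 1: "marks (table (accepts_by t) (pair n n)) n = weight (accepts_by t) n" for t
    by (intro marks_table prod_encode_less add_strict_mono) (auto simp: adjacent_def bit_less)
  have "color n = (\<Sum>t<n. of_bool (t = mu n \<and> odd (weight (accepts_by t) n)))"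
    unfolding color_def 1 div_exp_eq_1_iff using False by (intro sum.cong) auto
  also have "\<dots> = of_bool (mu n < n \<and> odd (weight (accepts_by (mu n)) n))"
    by (rule sum_of_bool_single)
  finally show ?thesis using False bit_less[OF bit_mu, of n] by simp
qed (simp add: color_def)

subsection \<open>Dependence on finitely many computations\<close>

definition agree :: "nat \<Rightarrow> rel5 \<Rightarrow> rel5 \<Rightarrow> bool" where
  "agree N G G' \<longleftrightarrow> (\<forall>e\<in>{..<N}. \<forall>v\<in>{..<2}. \<forall>x\<in>{..<N}. \<forall>a\<in>{..<N}. \<forall>b\<in>{..<N}.
     G e v x a b = G' e v x a b)"

lemma approx_agree:
  assumes "agree N G G'" "e < N" "j \<le> N" "x < N"
  shows "approx G e j x = approx G' e j x"
proof -
  have good: "good G e v x j a = good G' e v x j a" if "a < j" "v < 2" for v a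
    using assms that unfolding good_def agree_def by auto
  have "good G e 1 x j a \<and> (\<forall>a'<Suc a. \<not> good G e 0 x j a') \<longleftrightarrow>
    good G' e 1 x j a \<and> (\<forall>a'<Suc a. \<not> good G' e 0 x j a')" if "a < j" for a
    using good that by auto
  then show ?thesis unfolding approx_def by blast
qed

lemma claims_agree:
  assumes "agree N G G'" "e < N" "j \<le> N" "x < N"
  shows "claims G e j x = claims G' e j x"
proof -
  have "(\<Sum>y<x. of_bool (approx G e j y)) = (\<Sum>y<x. of_bool (approx G' e j y) :: nat)"
    using approx_agree[OF assms(1-3)] assms(4) by (intro sum.cong) auto
  then show ?thesis unfolding claims_def using approx_agree[OF assms] by simp
qed

lemma wins_agree:
  assumes "agree N G G'" "j \<le> N" "2 ^ Suc i \<le> N"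
  shows "wins G H i j = wins G' H i j"
proof -
  have "claims G e j x = claims G' e j x" if "e < j" "x < 2 ^ Suc i" for e x
    using assms that by (intro claims_agree[OF assms(1)]) auto
  then show ?thesis unfolding wins_def by (smt (verit) less_trans)
qed

text \<open>Entry \<open>k\<close> looks at numbers below \<open>2 ^ Suc (pi1 k)\<close> and at
  stage \<open>pi2 k\<close>; the crude bound \<open>2 ^ Suc k\<close> covers both.\<close>

lemma table_agree:
  assumes "agree N G G'" "2 ^ k \<le> N"
  shows "table G k = table G' k"
  using assms(2)
proof (induction k)
  case (Suc k)
  have pi: "pi1 k \<le> k" "pi2 k \<le> k"
    using le_prod_encode_1[of "pi1 k" "pi2 k"] le_prod_encode_2[of "pi2 k" "pi1 k"] by simp_all
  have "(2::nat) ^ Suc (pi1 k) \<le> 2 ^ Suc k" using pi by (intro power_increasing) auto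
  then have "2 ^ Suc (pi1 k) \<le> N" using Suc.prems by (rule order_trans)
  moreover have "pi2 k < 2 ^ Suc k" using pi(2) less_exp[of "Suc k"] by linarith
  ultimately have "wins G H (pi1 k) (pi2 k) = wins G' H (pi1 k) (pi2 k)" for H
    using Suc.prems by (intro wins_agree[OF assms(1)]) linarith+
  moreover have "table G k = table G' k" using Suc by simp
  ultimately show ?case by simp
qed simp

lemma marked_agree:
  assumes "agree N G G'" "2 ^ Suc (pair i j) \<le> N"
  shows "marked G i j = marked G' i j"
proof -
  have "bit (table G (Suc (pair i j))) (pair i j) = bit (table G' (Suc (pair i j))) (pair i j)"
    using table_agree[OF assms] by simp
  then show ?thesis unfolding bit_table by simp
qed

lemma accepts_by_mono: "accepts_by t e v x a b \<Longrightarrow> t \<le> t' \<Longrightarrow> accepts_by t' e v x a b"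
  unfolding accepts_by_def using bit_stage_mono less_le_trans by blast

text \<open>Each accepted tuple stays accepted from some stage on, rejected ones are never accepted,
  and only finitely many tuples are concerned.\<close>

lemma eventually_agree: "\<forall>\<^sub>F t in sequentially. agree N (accepts_by t) accepts"
proof -
  have "\<forall>\<^sub>F t in sequentially. accepts_by t e v x a b = accepts e v x a b" for e v x a b
  proof (cases "accepts e v x a b")
    case True
    then obtain t0 where "accepts_by t0 e v x a b" unfolding accepts_def by blast
    then have "accepts_by t e v x a b = accepts e v x a b" if "t0 \<le> t" for t
      using True that accepts_by_mono by blast
    then show ?thesis unfolding eventually_sequentially by blast
  next
    case False
    then show ?thesis unfolding accepts_def by simp
  qed
  then show ?thesis unfolding agree_def by (intro eventually_ball_finite ballI) auto
qed

subsection \<open>Indices and the limit lemma\<close>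

definition is_index :: "nat \<Rightarrow> nat set \<Rightarrow> bool" where
  "is_index e A \<longleftrightarrow> (\<forall>x. (x \<in> A \<longleftrightarrow> (\<exists>a. \<forall>b. accepts e 1 x a b)) \<and>
     (x \<notin> A \<longleftrightarrow> (\<exists>a. \<forall>b. accepts e 0 x a b)))"

lemma accepts_code:
  assumes t: "\<And>v x a b d. eval t [v, x, a, b, d] (of_bool (R v x a b d))"
  shows "accepts (recf_code t) v x a b \<longleftrightarrow> (\<exists>d. R v x a b d)"
proof
  assume "accepts (recf_code t) v x a b"
  then obtain d where "eval t [v, x, a, b, d] 1"
    unfolding accepts_def accepts_by_def using stage_sound by blast
  from eval_deterministic[OF this t] show "\<exists>d. R v x a b d" by (auto simp: of_bool_def split: if_splits)
next
  assume "\<exists>d. R v x a b d"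
  then obtain d where "R v x a b d" by blast
  then have "eval t [v, x, a, b, d] 1" using t[of v x a b d] by simp
  then have "\<forall>\<^sub>F s in sequentially. bit (stage s) (judg (recf_code t) (list_encode [v, x, a, b, d]) 1)"
    using stage_complete unfolding enumerated_def by blast
  with eventually_gt_at_top[of d]
  have "\<forall>\<^sub>F s in sequentially. accepts_by s (recf_code t) v x a b"
    by eventually_elim (auto simp: accepts_by_def)
  then show "accepts (recf_code t) v x a b"
    unfolding accepts_def by (metis eventually_happens' sequentially_bot)
qed

lemma decidable_recursive_rel4:
  assumes "recursive_rel4 P"
  shows "decidable (Suc (Suc (Suc (Suc 0)))) (\<lambda>v. P (hd v) (hd (tl v)) (hd (tl (tl v))) (hd (tl (tl (tl v)))))"
proof -
  from assms obtain t where "\<And>x a b d. eval t [x, a, b, d] (of_bool (P x a b d))"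
    unfolding recursive_rel4_def of_bool_def by blast
  moreover have "\<exists>x a b d. v = [x, a, b, d]" if "length v = Suc (Suc (Suc (Suc 0)))" for v :: "nat list"
    using that by (auto simp: length_Suc_conv)
  ultimately show ?thesis unfolding decidable_def computable_def by (metis list.sel(1,3))
qed

lemma Delta3_index:
  assumes "Delta3 A"
  shows "\<exists>e. is_index e A"
proof -
  from assms obtain P Q where P: "recursive_rel4 P" "\<And>x. x \<in> A \<longleftrightarrow> (\<exists>a. \<forall>b. \<exists>d. P x a b d)"
    and Q: "recursive_rel4 Q" "\<And>x. x \<in> A \<longleftrightarrow> (\<forall>a. \<exists>b. \<forall>d. Q x a b d)"
    unfolding Delta3_def Sigma3_def Pi3_def by blast
  \<comment> \<open>One program serves both halves: \<open>v\<close> selects the Sigma-3 matrix of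
    \<open>A\<close> or the negated Pi-3 matrix, which describes the complement in Sigma-3
    form.\<close>
  define R where "R v x a b d \<longleftrightarrow> 0 < v \<and> P x a b d \<or> v = 0 \<and> \<not> Q x a b d" for v x a b d :: nat
  have "decidable (Suc (Suc (Suc (Suc (Suc 0))))) (\<lambda>v. R (hd v) (hd (tl v)) (hd (tl (tl v)))
      (hd (tl (tl (tl v)))) (hd (tl (tl (tl (tl v))))))"
    unfolding R_def
    by (intro computable_intros decidable_comp4[OF decidable_recursive_rel4[OF P(1)]]
        decidable_comp4[OF decidable_recursive_rel4[OF Q(1)]])
  then obtain t where t: "\<And>v. length v = Suc (Suc (Suc (Suc (Suc 0)))) \<Longrightarrow>
      eval t v (of_bool (R (hd v) (hd (tl v)) (hd (tl (tl v))) (hd (tl (tl (tl v)))) (hd (tl (tl (tl (tl v)))))))"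
    unfolding decidable_def computable_def by auto
  have "eval t [v, x, a, b, d] (of_bool (R v x a b d))" for v x a b d
    using t[of "[v, x, a, b, d]"] by simp
  from accepts_code[OF this]
  have "accepts (recf_code t) 1 x a b \<longleftrightarrow> (\<exists>d. P x a b d)"
    "accepts (recf_code t) 0 x a b \<longleftrightarrow> (\<exists>d. \<not> Q x a b d)" for x a b
    by (simp_all add: R_def)
  then have "is_index (recf_code t) A" unfolding is_index_def using P(2) Q(2) by presburger
  then show ?thesis by blast
qed

text \<open>A true claim has a witness that is never refuted, while each witness of the false claim
  is eventually refuted. Hence the true claim ends up with the smaller surviving witness; ties count
  as nonmembership.\<close>

lemma eventually_approx:
  assumes "is_index e A"
  shows "\<forall>\<^sub>F j in sequentially. approx accepts e j x \<longleftrightarrow> x \<in> A"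
proof -
  have bad: "\<forall>\<^sub>F j in sequentially. \<forall>a\<in>{..<a0}. \<not> good accepts e v x j a"
    if "\<not> (\<exists>a. \<forall>b. accepts e v x a b)" for a0 v
  proof (intro eventually_ball_finite ballI)
    fix a
    from that obtain b where "\<not> accepts e v x a b" by blast
    then show "\<forall>\<^sub>F j in sequentially. \<not> good accepts e v x j a"
      by (intro eventually_mono[OF eventually_gt_at_top[of b]]) (auto simp: good_def)
  qed simp
  show ?thesis
  proof (cases "x \<in> A")
    case True
    then obtain a0 where a0: "\<forall>b. accepts e 1 x a0 b" using assms unfolding is_index_def by blast
    have "\<not> (\<exists>a. \<forall>b. accepts e 0 x a b)" using assms True unfolding is_index_def by blast
    from bad[OF this, of "Suc a0"] eventually_gt_at_top[of a0] show ?thesis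
      by eventually_elim (use True a0 in \<open>auto simp: approx_def good_def\<close>)
  next
    case False
    then obtain a0 where a0: "\<forall>b. accepts e 0 x a0 b" using assms unfolding is_index_def by blast
    have "\<not> (\<exists>a. \<forall>b. accepts e 1 x a b)" using assms False unfolding is_index_def by blast
    from bad[OF this, of a0] show ?thesis
    proof eventually_elim
      case (elim j)
      have "good accepts e 0 x j a0" using a0 by (simp add: good_def)
      then show ?case using False elim unfolding approx_def
        by (metis lessThan_iff less_Suc_eq_le not_le)
    qed
  qed
qed

subsection \<open>Serving every set\<close>

text \<open>Counting predecessors is injective on the elements of \<open>X\<close> and maps those in
  question into \<open>{..<N}\<close>.\<close>

lemma card_few_predecessors:
  "finite {x::nat. X x \<and> card ({..<x} \<inter> {y. X y}) < N} \<and>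
   card {x::nat. X x \<and> card ({..<x} \<inter> {y. X y}) < N} \<le> N"
proof -
  let ?S = "{x. X x \<and> card ({..<x} \<inter> {y. X y}) < N}"
  let ?f = "\<lambda>x. card ({..<x} \<inter> {y. X y})"
  have "?f x < ?f x'" if "x < x'" "X x" for x x'
    by (rule psubset_card_mono) (use that in auto)
  then have inj: "inj_on ?f ?S"
    by (intro linorder_inj_onI) (auto simp: less_imp_neq)
  have sub: "?f ` ?S \<subseteq> {..<N}" by auto
  show ?thesis
    using inj_on_finite[OF inj sub] card_inj_on_le[OF inj sub] by simp
qed

lemma card_claims: "finite {x. claims G e j x} \<and> card {x. claims G e j x} \<le> 2 ^ e"
  using card_few_predecessors[of "approx G e j" "2 ^ e"] by (simp add: claims_def sum_of_bool_eq)

lemma initial_segment_card: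
  assumes "infinite (A :: nat set)"
  shows "\<exists>m. card (A \<inter> {..<m}) = N"
proof (induction N)
  case 0
  show ?case by (rule exI[of _ 0]) simp
next
  case (Suc N)
  then obtain m where m: "card (A \<inter> {..<m}) = N" by blast
  have ex: "\<exists>a\<in>A. m \<le> a" using assms by (meson finite_nat_set_iff_bounded not_le)
  define a where "a = (LEAST a. a \<in> A \<and> m \<le> a)"
  have a: "a \<in> A" "m \<le> a" using LeastI_ex[of "\<lambda>a. a \<in> A \<and> m \<le> a"] ex unfolding a_def by auto
  have least: "a \<le> b" if "b \<in> A" "m \<le> b" for b unfolding a_def using that by (intro Least_le) auto
  have "A \<inter> {..<Suc a} = insert a (A \<inter> {..<m})"
    using a least by (auto simp: less_Suc_eq) (meson leD not_le)
  then have "card (A \<inter> {..<Suc a}) = Suc N" using m a by simp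
  then show ?case by blast
qed

lemma sum_exp_less: "(\<Sum>k<e. 2 ^ k) < (2::nat) ^ e"
  by (induction e) auto

text \<open>\<open>F\<close> consists of the first \<open>2 ^ e\<close> elements of
  \<open>A\<close>. Only \<open>F\<close> is fixed; the element served may vary with
  \<open>j\<close>.\<close>

lemma eventually_decided:
  assumes A: "A \<subseteq> {0<..}" "infinite A" "inj_on mu A" and e: "is_index e A"
  shows "\<exists>F\<subseteq>A. finite F \<and> (\<forall>\<^sub>F j in sequentially. \<exists>x\<in>F.
    marked accepts (mu x) j \<longleftrightarrow> even (weight accepts x))"
proof -
  obtain m where m: "card (A \<inter> {..<m}) = 2 ^ e" using initial_segment_card[OF A(2)] by blast
  let ?F = "A \<inter> {..<m}"
  have "\<forall>\<^sub>F j in sequentially. \<forall>y\<in>{..<m}. approx accepts e j y \<longleftrightarrow> y \<in> A"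
    using eventually_approx[OF e] by (intro eventually_ball_finite) auto
  moreover have "\<forall>\<^sub>F j in sequentially. \<forall>x\<in>?F. mu x < j"
    using eventually_gt_at_top by (intro eventually_ball_finite) auto
  ultimately have "\<forall>\<^sub>F j in sequentially. \<exists>x\<in>?F.
    marked accepts (mu x) j \<longleftrightarrow> even (weight accepts x)"
    using eventually_gt_at_top[of e]
  proof eventually_elim
    case (elim j)
    \<comment> \<open>Once the approximation is correct below \<open>m\<close>, \<open>F\<close>
      already fills the quota of \<open>2 ^ e\<close>, so wrong guesses from \<open>m\<close> on
      claim nothing.\<close>
    have claims: "claims accepts e j x \<longleftrightarrow> x \<in> ?F" for x
    proof (cases "x < m")
      case True
      then have eq: "{..<x} \<inter> {y. approx accepts e j y} = A \<inter> {..<x}" using elim(1) by auto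
      have "card (A \<inter> {..<x}) < card ?F" if "x \<in> A"
        by (rule psubset_card_mono) (use True that in auto)
      then show ?thesis using True elim(1) m by (auto simp: claims_def sum_of_bool_eq eq Int_commute)
    next
      case False
      then have "card ?F \<le> card ({..<x} \<inter> {y. approx accepts e j y})"
        using elim(1) by (intro card_mono) auto
      then show ?thesis using False m by (simp add: claims_def sum_of_bool_eq)
    qed
    \<comment> \<open>The positions claimed by smaller indices number at most 1 + 2 + ... +
      \<open>2 ^ (e - 1)\<close>, fewer than the \<open>2 ^ e\<close> distinct positions of
      \<open>F\<close>.\<close>
    let ?T = "\<Union>e'<e. mu ` {y. claims accepts e' j y}"
    have fin: "finite ?T" using card_claims by auto
    have "card ?T \<le> (\<Sum>e'<e. card (mu ` {y. claims accepts e' j y}))" by (rule card_UN_le) simp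
    also have "\<dots> \<le> (\<Sum>e'<e. 2 ^ e')"
      using card_claims card_image_le order_trans by (intro sum_mono) blast
    also have "\<dots> < 2 ^ e" by (rule sum_exp_less)
    also have "\<dots> = card (mu ` ?F)" using m A(3) by (metis card_image inf_le1 inj_on_subset)
    finally have "\<not> mu ` ?F \<subseteq> ?T" using card_mono[OF fin] by (meson not_le)
    then obtain x where x: "x \<in> ?F" "mu x \<notin> ?T" by blast
    have "0 < x" using x A(1) by auto
    have untaken: "\<not> claims accepts e' j y" if "e' < e" "mu y = mu x" for e' y
    proof
      assume "claims accepts e' j y"
      then have "mu y \<in> ?T" using that(1) by blast
      then show False using x(2) that(2) by simp
    qed
    have unique: "y = x" if "claims accepts e j y" "mu y = mu x" for y
      using that x(1) A(3) unfolding claims inj_on_def by auto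
    have "marked accepts (mu x) j \<longleftrightarrow> even (weight accepts x)"
    proof
      assume "marked accepts (mu x) j"
      then obtain e1 y where e1: "0 < y" "mu y = mu x" "claims accepts e1 j y" "even (weight accepts y)"
        "\<And>e' x'. e' < e1 \<Longrightarrow> 0 < x' \<Longrightarrow> mu x' = mu x \<Longrightarrow> \<not> claims accepts e' j x'"
        unfolding marked_iff by blast
      \<comment> \<open>A smaller \<open>e1\<close> contradicts \<open>untaken\<close>; a larger one
        is blocked because \<open>e\<close> itself claims \<open>x\<close>.\<close>
      have "e1 = e"
        using untaken[OF _ e1(2)] e1(3) e1(5)[OF _ \<open>0 < x\<close> refl] claims x(1) by (metis linorder_neqE_nat)
      then show "even (weight accepts x)" using e1 unique by auto
    next
      assume "even (weight accepts x)"
      then show "marked accepts (mu x) j"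
        unfolding marked_iff using elim x(1) claims \<open>0 < x\<close> untaken by blast
    qed
    then show ?case using x(1) by blast
  qed
  then show ?thesis by (intro exI[of _ ?F]) auto
qed

lemma color_differs:
  assumes A: "A \<subseteq> {0<..}" "infinite A" "Delta3 A" "weak_apart A"
  shows "\<exists>x\<in>A. \<exists>w1\<in>A. \<exists>w2\<in>A. x \<lless> w1 \<and> w1 \<lless> w2 \<and> color (w1 + w2) \<noteq> color (x + w1 + w2)"
proof -
  have inj: "inj_on mu A" and lam_fin: "\<And>l. finite {x \<in> A. lam x = l}"
    using A(4) unfolding weak_apart_def inj_on_def by auto
  have large: "\<exists>w\<in>A. l \<le> lam w" for l
  proof (rule ccontr)
    assume "\<not> ?thesis"
    then have "A \<subseteq> (\<Union>k<l. {x \<in> A. lam x = k})" by auto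
    moreover have "finite (\<Union>k<l. {x \<in> A. lam x = k})" using lam_fin by auto
    ultimately show False using A(2) finite_subset by blast
  qed
  obtain e where "is_index e A" using Delta3_index[OF A(3)] by blast
  from eventually_decided[OF A(1,2) inj this] obtain F where F: "F \<subseteq> A" "finite F"
    and ev: "\<forall>\<^sub>F j in sequentially. \<exists>x\<in>F. marked accepts (mu x) j \<longleftrightarrow> even (weight accepts x)"
    by blast
  have "\<forall>\<^sub>F j in sequentially. \<forall>x\<in>F. mu x < j"
    using F(2) eventually_gt_at_top by (intro eventually_ball_finite) auto
  from eventually_conj[OF ev this] obtain J where J: "\<And>j. J \<le> j \<Longrightarrow>
      (\<exists>x\<in>F. marked accepts (mu x) j \<longleftrightarrow> even (weight accepts x)) \<and> (\<forall>x\<in>F. mu x < j)"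
    unfolding eventually_sequentially by blast
  obtain w1 where w1: "w1 \<in> A" "J \<le> lam w1" using large by blast
  then obtain x where x: "x \<in> F" "marked accepts (mu x) (lam w1) \<longleftrightarrow> even (weight accepts x)"
    "mu x < lam w1" using J by blast
  have pos: "0 < x" "0 < w1" using x(1) w1(1) F(1) A(1) by auto
  \<comment> \<open>With \<open>w1\<close> and \<open>x\<close> fixed, only finitely many marks
    matter. From \<open>t0\<close> on they agree with those of the limit relation
    \<open>accepts\<close>.\<close>
  obtain t0 where t0: "\<And>t. t0 \<le> t \<Longrightarrow> agree (2 ^ Suc (pair (lam w1) (lam w1))) (accepts_by t) accepts"
    using eventually_agree unfolding eventually_sequentially by blast
  \<comment> \<open>The bound serves two purposes: \<open>mu w2\<close> is a stage beyond
    \<open>t0\<close>, and \<open>w2\<close> lies apart from \<open>w1\<close>.\<close>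
  obtain w2 where w2: "w2 \<in> A" "max t0 (Suc (mu w1)) \<le> lam w2" using large by blast
  have pos2: "0 < w2" using w2(1) A(1) by auto
  define t where "t = mu w2"
  have "lam w2 \<le> t" unfolding t_def using lam_le_bit bit_mu pos2 by blast
  then have "agree (2 ^ Suc (pair (lam w1) (lam w1))) (accepts_by t) accepts" using w2(2) by (intro t0) simp
  then have marked: "marked (accepts_by t) i j = marked accepts i j" if "i < j" "j \<le> lam w1" for i j
  proof (rule marked_agree)
    have "pair i j < pair (lam w1) (lam w1)" using that by (intro prod_encode_less) simp
    then show "(2::nat) ^ Suc (pair i j) \<le> 2 ^ Suc (pair (lam w1) (lam w1))" by simp
  qed
  have "weight (accepts_by t) x = weight accepts x"
    unfolding weight_def
  proof (rule arg_cong[of _ _ card], intro Collect_cong, clarify, intro conj_cong refl)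
    fix i j assume "adjacent x i j"
    then have "i < j" "j \<le> mu x" using bit_le_mu by (auto simp: adjacent_def)
    then show "marked (accepts_by t) i j = marked accepts i j" using x(3) by (intro marked) auto
  qed
  moreover have "marked (accepts_by t) (mu x) (lam w1) = marked accepts (mu x) (lam w1)"
    using x(3) by (intro marked) auto
  \<comment> \<open>This sum is exactly what prepending \<open>x\<close> adds to the weight of
    \<open>w1 + w2\<close>, at the common stage \<open>t\<close>.\<close>
  ultimately have flip: "odd (weight (accepts_by t) x + of_bool (marked (accepts_by t) (mu x) (lam w1)))"
    using x(2) by auto
  let ?v = "w1 + w2"
  have apart: "mu w1 < lam w2" using w2(2) by simp
  have v: "0 < ?v" "mu ?v = t" "lam ?v = lam w1"
    using mu_lam_add[OF pos(2) pos2 apart] pos by (auto simp: t_def)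
  have "mu x < lam ?v" using x(3) v(3) by simp
  note xv = mu_lam_add(1)[OF pos(1) v(1) this] weight_add[OF pos(1) v(1) this]
  have "color ?v \<noteq> color (x + ?v)"
    unfolding color_eq xv v(2) using flip v pos by (auto simp: v(3))
  moreover have "x \<lless> w1" "w1 \<lless> w2" using ll_iff pos pos2 x(3) apart by auto
  ultimately show ?thesis using x(1) F(1) w1(1) w2(1) by (auto simp: add.assoc)
qed

theorem theorem2p7:
  shows "\<exists>r::nat. r \<ge> 2 \<and> (\<exists>c :: nat \<Rightarrow> nat. recursive_fun c \<and> (\<forall>n. c n < r) \<and>
     (\<forall>A :: nat set. A \<subseteq> {0<..} \<and> infinite A \<and> Delta3 A \<and> weak_apart A \<longrightarrow>
        (\<exists>x \<in> A. \<exists>w1 \<in> A. \<exists>w2 \<in> A. x \<lless> w1 \<and> w1 \<lless> w2 \<and> c (w1 + w2) \<noteq> c (x + w1 + w2))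
        \<and> \<not> (\<exists>k. \<forall>y \<in> FS3 A. c y = k)))"
proof (intro exI[of _ 2] conjI exI[of _ color] allI impI)
  show "recursive_fun color" by (rule recursive_color)
  show "color n < 2" for n by (simp add: color_eq)
next
  fix A :: "nat set"
  assume "A \<subseteq> {0<..} \<and> infinite A \<and> Delta3 A \<and> weak_apart A"
  then show *: "\<exists>x \<in> A. \<exists>w1 \<in> A. \<exists>w2 \<in> A. x \<lless> w1 \<and> w1 \<lless> w2 \<and> color (w1 + w2) \<noteq> color (x + w1 + w2)"
    using color_differs by blast
  then obtain x w1 w2 where w: "x \<in> A" "w1 \<in> A" "w2 \<in> A" "x \<lless> w1" "w1 \<lless> w2"
    "color (w1 + w2) \<noteq> color (x + w1 + w2)" by blast
  then have "x < w1" "w1 < w2" by (auto simp: ll_def)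
  then have "\<Sum>{w1, w2} = w1 + w2" "\<Sum>{x, w1, w2} = x + w1 + w2" "card {w1, w2} \<le> 3" "card {x, w1, w2} \<le> 3"
    by auto
  then have "w1 + w2 \<in> FS3 A" "x + w1 + w2 \<in> FS3 A"
    unfolding FS3_def using w(1-3)
    by (metis (mono_tags, lifting) CollectI empty_subsetI finite.intros insert_not_empty insert_subset)+
  then show "\<not> (\<exists>k. \<forall>y \<in> FS3 A. color y = k)" using w(6) by metis
qed simp

end
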